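(* Let $G$ be a connected graph with $n\ge 2$ vertices. Then $$B(G)\ge\frac{Kf(G)^2}{n(n-1)},$$ with equality if and only if $G$ is isomorphic to the complete graph $K_n$.
   Context: All graphs are finite, simple and undirected. The Laplacian matrix of $G$ is $L=D-A$ ($A$ adjacency matrix, $D$ diagonal degree matrix). $L^{+}$ is the Moore–Penrose inverse of $L$ and $L^{2+}=(L^{+})^2$. The biharmonic distance is the nonnegative number $d_B(u,v)$ with $d_B^2(u,v)=L^{2+}_{uu}+L^{2+}_{vv}-2L^{2+}_{uv}$, and the biharmonic index is $B(G)=\frac12\sum_{u\in V(G)}\sum_{v\in V(G)}d_B^2(u,v)$. The resistance distance between vertices $v_i,v_j$ is $r_{ij}=L^{+}_{ii}+L^{+}_{jj}-2L^{+}_{ij}$, and the Kirchhoff index is $Kf(G)=\sum_{i<j}r_{ij}$. *)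

theory Defs
  imports
    "HOL-Analysis.Analysis"
    "HOL-Library.Countable"
    "Graph_Theory.Graph_Theory"
begin

text \<open>
  Graphs are those of the AFP entry \<open>Graph_Theory\<close>: the locale predicate \<open>Digraph.graph\<close> holds of
  finite symmetric digraphs without loops and multiple arcs, an undirected edge being a pair of
  opposite arcs. Matrices are indexed by the vertex type, so the definitions below are meant for
  graphs with \<open>verts G = UNIV\<close>.
\<close>

definition adjacency_matrix :: "('v::finite, 'e) pre_digraph \<Rightarrow> real^'v^'v" where
  "adjacency_matrix G = (\<chi> u v. if u \<rightarrow>\<^bsub>G\<^esub> v then 1 else 0)"

text \<open>In a symmetric digraph without multiple arcs the out-degree is the number of neighbours.\<close>

definition degree_matrix :: "('v::finite, 'e) pre_digraph \<Rightarrow> real^'v^'v" where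
  "degree_matrix G = (\<chi> u v. if u = v then real (out_degree G u) else 0)"

definition laplacian :: "('v::finite, 'e) pre_digraph \<Rightarrow> real^'v^'v" where
  "laplacian G = degree_matrix G - adjacency_matrix G"

definition is_moore_penrose :: "real^'n^'m \<Rightarrow> real^'m^'n \<Rightarrow> bool" where
  "is_moore_penrose A X \<longleftrightarrow>
     A ** X ** A = A \<and> X ** A ** X = X \<and>
     transpose (A ** X) = A ** X \<and> transpose (X ** A) = X ** A"

text \<open>Exactly one matrix satisfies the four Penrose equations, for every real matrix.\<close>

definition moore_penrose :: "real^'n^'m \<Rightarrow> real^'m^'n" where
  "moore_penrose A = (THE X. is_moore_penrose A X)"

text \<open>
  The radicand is nonnegative because the squared pseudoinverse of the Laplacian is positive
  semidefinite.
\<close>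

definition biharmonic_dist :: "('v::finite, 'e) pre_digraph \<Rightarrow> 'v \<Rightarrow> 'v \<Rightarrow> real" where
  "biharmonic_dist G u v =
     (let M = moore_penrose (laplacian G) ** moore_penrose (laplacian G)
      in sqrt (M $ u $ u + M $ v $ v - 2 * M $ u $ v))"

definition biharmonic_index :: "('v::finite, 'e) pre_digraph \<Rightarrow> real" where
  "biharmonic_index G =
     1 / 2 * (\<Sum>u\<in>verts G. \<Sum>v\<in>verts G. (biharmonic_dist G u v)\<^sup>2)"

definition resistance_dist :: "('v::finite, 'e) pre_digraph \<Rightarrow> 'v \<Rightarrow> 'v \<Rightarrow> real" where
  "resistance_dist G u v =
     (let M = moore_penrose (laplacian G)
      in M $ u $ u + M $ v $ v - 2 * M $ u $ v)"

text \<open>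
  The sum over \<open>i < j\<close> needs a numbering of the vertices. Any injection into \<open>nat\<close> serves, and
  \<open>to_nat\<close> is one; by symmetry of the resistance distance the value does not depend on it.
\<close>

definition kirchhoff_index :: "('v::finite, 'e) pre_digraph \<Rightarrow> real" where
  "kirchhoff_index G =
     (\<Sum>(u, v)\<in>{(u, v). u \<in> verts G \<and> v \<in> verts G \<and> to_nat u < to_nat v}. resistance_dist G u v)"

definition complete_graph :: "nat \<Rightarrow> (nat, nat \<times> nat) pre_digraph" where
  "complete_graph n =
     \<lparr>verts = {..<n}, arcs = {(i, j). i < n \<and> j < n \<and> i \<noteq> j}, tail = fst, head = snd\<rparr>"

lemma complete_digraph_complete_graph: "complete_digraph n (complete_graph n)"
proof -
  have "arcs (complete_graph n) \<subseteq> {..<n} \<times> {..<n}"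
    by (auto simp: complete_graph_def)
  then have "finite (arcs (complete_graph n))"
    by (rule finite_subset) simp
  then have "Digraph.graph (complete_graph n)"
    by unfold_locales
      (auto simp: complete_graph_def symmetric_def arcs_ends_conv arc_to_ends_def sym_def image_iff)
  then show ?thesis
    by (auto simp: complete_digraph_def complete_graph_def arcs_ends_conv image_iff)
qed

end

theory Submission
  imports Defs
begin

text \<open>
  Write \<open>X\<close> for the pseudoinverse of the Laplacian and \<open>P = I - J/n\<close> for the projection onto the
  orthogonal complement of the constant vectors. Since \<open>X\<close> is symmetric and annihilates constants,
  the Kirchhoff index is \<open>n tr X = n \<langle>X, P\<rangle>\<close> and the biharmonic index is \<open>n tr X\<^sup>2 = n \<langle>X, X\<rangle>\<close> in
  the Frobenius inner product. As \<open>\<langle>P, P\<rangle> = n - 1\<close>, the inequality is that of Cauchy and Schwarz,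
  with equality iff \<open>X\<close> is a multiple of \<open>P\<close>; equivalently, iff the Laplacian is a multiple of \<open>P\<close>,
  which forces all its off-diagonal entries to be nonzero.
\<close>

section \<open>The Moore--Penrose inverse\<close>

text \<open>Both \<open>A ** X\<close> and \<open>A ** Y\<close> are the orthogonal projection onto
  the column space of \<open>A\<close>, hence equal; likewise \<open>X ** A = Y ** A\<close>. Then
  \<open>X = X ** A ** X = Y ** A ** X = Y ** A ** Y = Y\<close>.\<close>

lemma is_moore_penrose_unique:
  fixes A :: "real^'n^'m"
  assumes "is_moore_penrose A X" and "is_moore_penrose A Y"
  shows "X = Y"
proof -
  note X = assms(1)[unfolded is_moore_penrose_def] and Y = assms(2)[unfolded is_moore_penrose_def]
  have "A ** X = transpose (A ** Y ** (A ** X))"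
    using X Y by (simp add: matrix_mul_assoc)
  also have "\<dots> = A ** X ** (A ** Y)"
    using X Y by (simp add: matrix_transpose_mul)
  also have "\<dots> = A ** Y"
    using X by (simp add: matrix_mul_assoc)
  finally have AX: "A ** X = A ** Y" .
  have "X ** A ** (Y ** A) = X ** (A ** Y ** A)"
    by (simp only: matrix_mul_assoc)
  then have "X ** A = transpose (X ** A ** (Y ** A))"
    using X Y by simp
  also have "\<dots> = Y ** A ** (X ** A)"
    using X Y by (simp add: matrix_transpose_mul)
  also have "\<dots> = Y ** (A ** X ** A)"
    by (simp only: matrix_mul_assoc)
  also have "\<dots> = Y ** A"
    using X by simp
  finally have XA: "X ** A = Y ** A" .
  have "X = X ** A ** X"
    using X by simp
  also have "\<dots> = Y ** (A ** X)"
    by (simp add: XA matrix_mul_assoc)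
  also have "\<dots> = Y"
    using Y by (simp add: AX matrix_mul_assoc)
  finally show ?thesis .
qed

lemma moore_penrose_eqI: "is_moore_penrose A X \<Longrightarrow> moore_penrose A = X"
  unfolding moore_penrose_def by (blast intro: the_equality is_moore_penrose_unique)

section \<open>The centering matrix\<close>

definition centering :: "real^'n^'n" where
  "centering = (\<chi> u v. (if u = v then 1 else 0) - 1 / real CARD('n))"

lemma transpose_centering: "transpose centering = centering"
  by (simp add: centering_def transpose_def vec_eq_iff)

text \<open>The rows of \<open>A\<close> sum to zero, so the \<open>J/n\<close> part of
  \<open>centering\<close> contributes nothing.\<close>

lemma matrix_mult_centering:
  fixes A :: "real^'n^'m"
  assumes "A *v 1 = 0"
  shows "A ** centering = A"
proof -
  have "(\<Sum>k\<in>UNIV. A $ i $ k) = 0" for i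
    using assms by (simp add: vec_eq_iff matrix_vector_mult_def)
  then show ?thesis
    by (simp add: centering_def matrix_matrix_mult_def vec_eq_iff algebra_simps sum_subtractf
        if_distrib[of "(*) _"] flip: sum_divide_distrib cong: if_cong)
qed

lemma centering_one: "centering *v 1 = (0 :: real^'n)"
  by (simp add: centering_def vec_eq_iff matrix_vector_mult_def sum_subtractf)

section \<open>Frobenius inner products with the centering matrix\<close>

lemma inner_matrix: "A \<bullet> B = (\<Sum>u\<in>UNIV. \<Sum>v\<in>UNIV. A $ u $ v * B $ u $ v)"
  for A B :: "real^'n^'m"
  by (simp add: inner_vec_def)

lemma inner_centering:
  fixes A :: "real^'n^'n"
  assumes "A *v 1 = 0"
  shows "A \<bullet> centering = trace A"
proof -
  have "A \<bullet> centering = trace (A ** transpose centering)"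
    by (simp add: inner_matrix trace_def matrix_matrix_mult_def transpose_def)
  then show ?thesis
    by (simp add: transpose_centering matrix_mult_centering assms)
qed

lemma trace_centering: "trace (centering :: real^'n^'n) = real CARD('n) - 1"
  by (simp add: trace_def centering_def sum_subtractf right_diff_distrib)

text \<open>The coefficient is \<langle>A, P\<rangle> / \<langle>P, P\<rangle>, so this is
  Pythagoras for the orthogonal projection of \<open>A\<close> onto the line spanned by
  \<open>centering\<close>: Cauchy-Schwarz with its defect made explicit.\<close>

lemma norm_centering_residual:
  fixes A :: "real^'n^'n"
  assumes "A *v 1 = 0" and "CARD('n) \<ge> 2"
  shows "(norm (A - (trace A / (real CARD('n) - 1)) *\<^sub>R centering))\<^sup>2
    = A \<bullet> A - (trace A)\<^sup>2 / (real CARD('n) - 1)"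
proof -
  have "centering \<bullet> (centering :: real^'n^'n) = real CARD('n) - 1"
    by (simp add: inner_centering[OF centering_one] trace_centering)
  moreover have "A \<bullet> centering = trace A" and "centering \<bullet> A = trace A"
    using inner_centering[OF assms(1)] by (simp_all add: inner_commute)
  ultimately have "(norm (A - c *\<^sub>R centering))\<^sup>2
      = A \<bullet> A - 2 * c * trace A + c * c * (real CARD('n) - 1)" for c
    by (simp add: power2_norm_eq_inner inner_diff_left inner_diff_right right_diff_distrib)
  moreover have "real CARD('n) - 1 \<noteq> 0"
    using assms(2) by simp
  ultimately show ?thesis
    by (simp add: power2_eq_square)
qed

text \<open>The cross terms vanish by the zero row sums, and each diagonal term is summed n times.
  Both indices use this, with \<open>M\<close> the pseudoinverse or its square.\<close>

lemma sum_sum_distance_form: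
  fixes M :: "real^'n^'n"
  assumes "M *v 1 = 0"
  shows "(\<Sum>u\<in>UNIV. \<Sum>v\<in>UNIV. M $ u $ u + M $ v $ v - 2 * M $ u $ v)
    = 2 * real CARD('n) * trace M"
proof -
  have "(\<Sum>k\<in>UNIV. M $ i $ k) = 0" for i
    using assms by (simp add: vec_eq_iff matrix_vector_mult_def)
  then show ?thesis
    by (simp add: sum.distrib sum_subtractf trace_def flip: sum_distrib_left)
qed

section \<open>The Laplacian of a connected graph\<close>

lemma out_degree_eq_sum_adjacency:
  fixes G :: "('v::finite, 'e) pre_digraph"
  assumes "Digraph.graph G"
  shows "real (out_degree G u) = (\<Sum>v\<in>UNIV. adjacency_matrix G $ u $ v)"
proof -
  interpret Digraph.graph G by fact
  \<comment> \<open>\<open>out_degree\<close> counts arcs; without multiple arcs, distinct arcs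
    leaving \<open>u\<close> have distinct heads, so it counts neighbours.\<close>
  have "inj_on (head G) (out_arcs G u)"
    by (auto simp: inj_on_def arc_to_ends_def intro!: no_multi_arcs)
  moreover have "head G ` out_arcs G u = {v. u \<rightarrow>\<^bsub>G\<^esub> v}"
    by (auto simp: arcs_ends_conv image_iff)
  ultimately have "out_degree G u = card {v. u \<rightarrow>\<^bsub>G\<^esub> v}"
    unfolding out_degree_def by (metis card_image)
  then show ?thesis
    by (simp add: adjacency_matrix_def flip: sum.inter_filter)
qed

lemma laplacian_nth:
  fixes G :: "('v::finite, 'e) pre_digraph"
  assumes "Digraph.graph G"
  shows "laplacian G $ u $ v
    = (if u = v then \<Sum>w\<in>UNIV. adjacency_matrix G $ u $ w else 0) - adjacency_matrix G $ u $ v"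
  by (simp add: laplacian_def degree_matrix_def out_degree_eq_sum_adjacency[OF assms])

lemma adjacency_matrix_sym:
  fixes G :: "('v::finite, 'e) pre_digraph"
  assumes "Digraph.graph G"
  shows "adjacency_matrix G $ u $ v = adjacency_matrix G $ v $ u"
proof -
  interpret Digraph.graph G by fact
  have "u \<rightarrow>\<^bsub>G\<^esub> v \<longleftrightarrow> v \<rightarrow>\<^bsub>G\<^esub> u"
    using sym_arcs by (auto simp: symmetric_def dest: symD)
  then show ?thesis
    by (simp add: adjacency_matrix_def)
qed

lemma transpose_laplacian:
  fixes G :: "('v::finite, 'e) pre_digraph"
  assumes "Digraph.graph G"
  shows "transpose (laplacian G) = laplacian G"
  by (simp add: vec_eq_iff transpose_def laplacian_nth[OF assms] adjacency_matrix_sym[OF assms])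

lemma laplacian_mult_vec_nth:
  fixes G :: "('v::finite, 'e) pre_digraph"
  assumes "Digraph.graph G"
  shows "(laplacian G *v x) $ u = (\<Sum>v\<in>UNIV. adjacency_matrix G $ u $ v * (x $ u - x $ v))"
  by (simp add: matrix_vector_mult_def laplacian_nth[OF assms] left_diff_distrib
      right_diff_distrib sum_subtractf sum_distrib_right if_distrib[of "\<lambda>y. y * _"] cong: if_cong)

lemma laplacian_one:
  fixes G :: "('v::finite, 'e) pre_digraph"
  assumes "Digraph.graph G"
  shows "laplacian G *v 1 = 0"
  by (simp add: vec_eq_iff laplacian_mult_vec_nth[OF assms])

text \<open>Each square splits into two terms that are exchanged by swapping \<open>u\<close> and
  \<open>v\<close>. The factor 2 appears because the double sum meets each edge in both
  directions.\<close>

lemma laplacian_quadratic_form: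
  fixes G :: "('v::finite, 'e) pre_digraph"
  assumes "Digraph.graph G"
  shows "(\<Sum>u\<in>UNIV. \<Sum>v\<in>UNIV. adjacency_matrix G $ u $ v * (x $ u - x $ v)\<^sup>2)
    = 2 * (x \<bullet> (laplacian G *v x))"
proof -
  let ?a = "\<lambda>u v. adjacency_matrix G $ u $ v"
  have "(\<Sum>u\<in>UNIV. \<Sum>v\<in>UNIV. ?a u v * (x $ u - x $ v)\<^sup>2)
      = (\<Sum>u\<in>UNIV. \<Sum>v\<in>UNIV. ?a u v * (x $ u - x $ v) * x $ u)
        + (\<Sum>u\<in>UNIV. \<Sum>v\<in>UNIV. ?a u v * (x $ v - x $ u) * x $ v)"
    by (simp add: power2_eq_square algebra_simps flip: sum.distrib)
  also have "(\<Sum>u\<in>UNIV. \<Sum>v\<in>UNIV. ?a u v * (x $ v - x $ u) * x $ v)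
      = (\<Sum>u\<in>UNIV. \<Sum>v\<in>UNIV. ?a u v * (x $ u - x $ v) * x $ u)"
    by (subst sum.swap) (simp add: adjacency_matrix_sym[OF assms])
  also have "(\<Sum>u\<in>UNIV. \<Sum>v\<in>UNIV. ?a u v * (x $ u - x $ v) * x $ u) = x \<bullet> (laplacian G *v x)"
    by (simp add: inner_vec_def laplacian_mult_vec_nth[OF assms] sum_distrib_left mult_ac)
  finally show ?thesis
    by simp
qed

text \<open>The quadratic form vanishes at \<open>x\<close> and is a sum of nonnegative terms, so
  \<open>x\<close> agrees at the ends of every arc, and connectedness spreads this to all
  vertices.\<close>

lemma laplacian_kernel_const:
  fixes G :: "('v::finite, 'e) pre_digraph"
  assumes G: "Digraph.graph G" and UNIV: "verts G = UNIV" and conn: "Digraph_Component.connected G"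
    and zero: "laplacian G *v x = 0"
  shows "x $ u = x $ v"
proof -
  interpret Digraph.graph G by fact
  have nonneg: "adjacency_matrix G $ u $ v * (x $ u - x $ v)\<^sup>2 \<ge> 0" for u v
    by (simp add: adjacency_matrix_def)
  have "(\<Sum>u\<in>UNIV. \<Sum>v\<in>UNIV. adjacency_matrix G $ u $ v * (x $ u - x $ v)\<^sup>2) = 0"
    by (simp add: laplacian_quadratic_form[OF G] zero)
  then have summand: "adjacency_matrix G $ u $ v * (x $ u - x $ v)\<^sup>2 = 0" for u v
    using nonneg by (simp add: sum_nonneg_eq_0_iff sum_nonneg)
  then have adj: "x $ u = x $ v" if "u \<rightarrow>\<^bsub>G\<^esub> v" for u v
    using that summand[of u v] by (simp add: adjacency_matrix_def)
  \<comment> \<open>\<open>connected\<close> ignores the direction of arcs; symmetry turns it into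
    directed reachability.\<close>
  have "strongly_connected G"
    using symmetric_connected_imp_strongly_connected sym_arcs conn by blast
  then have "u \<rightarrow>\<^sup>*\<^bsub>G\<^esub> v"
    by (simp add: strongly_connected_def UNIV)
  then show ?thesis
    by (induction rule: converse_reachable_induct) (auto simp: adj)
qed

text \<open>The pseudoinverse is exhibited as (L + J)^(-1) P, which inverts \<open>L\<close> on the
  complement of the constants and annihilates the constants.\<close>

lemma laplacian_pseudoinverse:
  fixes G :: "('v::finite, 'e) pre_digraph"
  assumes G: "Digraph.graph G" and "verts G = UNIV" and "Digraph_Component.connected G"
  defines "L \<equiv> laplacian G" and "X \<equiv> moore_penrose (laplacian G)"
  shows "transpose X = X" and "X *v 1 = 0" and "L ** X = centering"
proof -
  define J :: "real^'v^'v" where "J = (\<chi> u v. 1)"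
  have J: "J *v x = (\<Sum>u\<in>UNIV. x $ u) *\<^sub>R 1" for x
    by (simp add: J_def vec_eq_iff matrix_vector_mult_def)
  have L1: "L *v 1 = 0" and LT: "transpose L = L"
    by (simp_all add: L_def laplacian_one[OF G] transpose_laplacian[OF G])
  \<comment> \<open>Adding \<open>J\<close> makes the Laplacian invertible without changing it on the range of \<open>centering\<close>.\<close>
  have "x = 0" if x: "(L + J) *v x = 0" for x
  proof -
    have eq: "L *v x + (\<Sum>u\<in>UNIV. x $ u) *\<^sub>R 1 = 0"
      using x by (simp add: matrix_vector_mult_add_rdistrib J)
    have "1 \<bullet> (L *v x) = (L *v 1) \<bullet> x"
      by (metis LT dot_lmul_matrix transpose_matrix_vector)
    \<comment> \<open>Pairing with the constant vector removes \<open>L *v x\<close> and isolates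
      the coordinate sum. Once that sum is zero, \<open>x\<close> lies in the kernel of
      \<open>L\<close>, so it is constant and therefore zero.\<close>
    then have "1 \<bullet> ((\<Sum>u\<in>UNIV. x $ u) *\<^sub>R (1 :: real^'v)) = 0"
      using arg_cong[OF eq, of "inner 1"] by (simp add: inner_add_right L1)
    then have sum0: "(\<Sum>u\<in>UNIV. x $ u) = 0"
      by (simp add: inner_vec_def)
    with eq have const: "x $ u = x $ v" for u v
      using laplacian_kernel_const[OF assms(1-3), of x] by (simp add: L_def)
    have "x $ u = 0" for u
    proof -
      have "(\<Sum>v\<in>UNIV. x $ v) = (\<Sum>v\<in>(UNIV :: 'v set). x $ u)"
        by (intro sum.cong const) simp
      then show ?thesis
        by (simp add: sum0)
    qed
    then show "x = 0"
      by (simp add: vec_eq_iff)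
  qed
  then obtain Y where YN: "Y ** (L + J) = mat 1"
    using matrix_left_invertible_ker by blast
  then have NY: "(L + J) ** Y = mat 1"
    by (simp add: matrix_left_right_inverse)
  have LP: "L ** centering = L"
    using L1 by (rule matrix_mult_centering)
  then have PL: "centering ** L = L"
    by (metis LT matrix_transpose_mul transpose_centering)
  have JP: "J ** centering = 0"
    by (simp add: J_def centering_def matrix_matrix_mult_def vec_eq_iff sum_subtractf)
  have JT: "transpose J = J"
    by (simp add: J_def transpose_def)
  have "centering ** J = transpose (J ** centering)"
    by (simp add: matrix_transpose_mul JT transpose_centering)
  then have PJ: "centering ** J = 0"
    by (simp add: JP transpose_def vec_eq_iff)
  have NT: "transpose (L + J) = L + J"
    using LT JT by (simp add: transpose_def vec_eq_iff)
  have PN: "centering ** (L + J) = L"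
    by (simp add: matrix_add_ldistrib PL PJ)
  then have NP: "(L + J) ** centering = L"
    by (metis LT NT matrix_transpose_mul transpose_centering)
  have PP: "centering ** centering = (centering :: real^'v^'v)"
    using centering_one by (rule matrix_mult_centering)
  \<comment> \<open>Cancel \<open>L + J\<close> against its inverse \<open>Y\<close> in
    \<open>NP\<close> and \<open>PN\<close>.\<close>
  have YL: "Y ** L = centering"
    by (metis NP YN matrix_mul_assoc matrix_mul_lid)
  have LY: "L ** Y = centering"
    by (metis PN NY matrix_mul_assoc matrix_mul_rid)
  \<comment> \<open>Both sides equal \<open>Y ** L ** Y\<close>.\<close>
  have comm: "centering ** Y = Y ** centering"
    by (metis YL LY matrix_mul_assoc)
  have "transpose Y = Y"
    by (metis NT NY YN matrix_mul_assoc matrix_mul_lid matrix_mul_rid matrix_transpose_mul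
        transpose_mat)
  \<comment> \<open>\<open>Y\<close> still acts on constants as 1/n; the factor
    \<open>centering\<close> removes that part.\<close>
  define Z where "Z = Y ** centering"
  have LZ: "L ** Z = centering"
    by (simp add: Z_def matrix_mul_assoc LY PP)
  have ZL: "Z ** L = centering"
    by (metis Z_def PL YL matrix_mul_assoc)
  \<comment> \<open>Both products of \<open>L\<close> and \<open>Z\<close> are the symmetric matrix
    \<open>centering\<close>, so what remains after simplification is
    \<open>centering ** Z = Z\<close>.\<close>
  have "is_moore_penrose L Z"
    by (simp add: is_moore_penrose_def LZ ZL PL transpose_centering)
      (metis Z_def comm PP matrix_mul_assoc)
  then have XZ: "X = Z"
    unfolding X_def L_def by (rule moore_penrose_eqI)
  show "transpose X = X"
    by (simp add: XZ Z_def matrix_transpose_mul transpose_centering \<open>transpose Y = Y\<close> comm)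
  show "X *v 1 = 0"
    by (simp add: XZ Z_def centering_one flip: matrix_vector_mul_assoc)
  show "L ** X = centering"
    by (simp add: XZ LZ)
qed

section \<open>The two indices as traces\<close>

text \<open>The sum over all ordered pairs is twice the index: diagonal terms vanish, and swapping
  the vertices matches the pairs above the diagonal with those below.\<close>

lemma kirchhoff_index_eq_trace:
  fixes G :: "('v::finite, 'e) pre_digraph"
  assumes "Digraph.graph G" and UNIV: "verts G = UNIV" and "Digraph_Component.connected G"
  shows "kirchhoff_index G = real CARD('v) * trace (moore_penrose (laplacian G))"
proof -
  define X where "X = moore_penrose (laplacian G)"
  note X = laplacian_pseudoinverse[OF assms, folded X_def]
  let ?r = "resistance_dist G"
  let ?S = "{(u, v). to_nat u < to_nat (v :: 'v)}" and ?T = "{(u, v). to_nat (v :: 'v) < to_nat u}"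
  have r: "?r u v = X $ u $ u + X $ v $ v - 2 * X $ u $ v" for u v
    by (simp add: resistance_dist_def Let_def X_def)
  have "X $ u $ v = X $ v $ u" for u v
    using X(1) by (metis transpose_def vec_lambda_beta)
  then have r_sym: "?r u v = ?r v u" for u v
    by (simp add: r)
  \<comment> \<open>Injectivity of \<open>to_nat\<close> leaves only the diagonal outside
    \<open>?S \<union> ?T\<close>.\<close>
  have cases: "u = v \<or> to_nat u < to_nat v \<or> to_nat v < to_nat u" for u v :: 'v
    by (metis injD inj_to_nat linorder_neqE_nat)
  have "(\<Sum>u\<in>UNIV. \<Sum>v\<in>UNIV. ?r u v) = (\<Sum>(u, v)\<in>UNIV. ?r u v)"
    by (simp add: sum.cartesian_product)
  also have "\<dots> = (\<Sum>(u, v)\<in>?S \<union> ?T. ?r u v)"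
  proof (rule sum.mono_neutral_right)
    show "\<forall>p\<in>UNIV - (?S \<union> ?T). (case p of (u, v) \<Rightarrow> ?r u v) = 0"
    proof
      fix p :: "'v \<times> 'v" assume "p \<in> UNIV - (?S \<union> ?T)"
      then have "fst p = snd p"
        using cases[of "fst p" "snd p"] by (simp add: case_prod_beta)
      then show "(case p of (u, v) \<Rightarrow> ?r u v) = 0"
        by (simp add: case_prod_beta r)
    qed
  qed auto
  also have "\<dots> = (\<Sum>(u, v)\<in>?S. ?r u v) + (\<Sum>(u, v)\<in>?T. ?r u v)"
    by (rule sum.union_disjoint) auto
  also have "(\<Sum>(u, v)\<in>?T. ?r u v) = (\<Sum>(u, v)\<in>?S. ?r u v)"
    by (rule sum.reindex_bij_witness[of _ prod.swap prod.swap]) (auto simp: r_sym)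
  finally have "2 * kirchhoff_index G = (\<Sum>u\<in>UNIV. \<Sum>v\<in>UNIV. ?r u v)"
    by (simp add: kirchhoff_index_def UNIV)
  then show ?thesis
    using sum_sum_distance_form[OF X(2)] by (simp add: r X_def)
qed

lemma biharmonic_index_eq_inner:
  fixes G :: "('v::finite, 'e) pre_digraph"
  assumes "Digraph.graph G" and UNIV: "verts G = UNIV" and "Digraph_Component.connected G"
  shows "biharmonic_index G
    = real CARD('v) * (moore_penrose (laplacian G) \<bullet> moore_penrose (laplacian G))"
proof -
  define X where "X = moore_penrose (laplacian G)"
  note X = laplacian_pseudoinverse[OF assms, folded X_def]
  have X_sym: "X $ u $ v = X $ v $ u" for u v
    using X(1) by (metis transpose_def vec_lambda_beta)
  define M where "M = X ** X"
  have M: "M $ u $ v = (\<Sum>w\<in>UNIV. X $ u $ w * X $ v $ w)" for u v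
    by (simp add: M_def matrix_matrix_mult_def X_sym[of _ v])
  \<comment> \<open>\<open>M\<close> is the Gram matrix of the rows of \<open>X\<close>, so the
    radicand is the squared Euclidean distance between two rows; being nonnegative, it survives
    \<open>sqrt\<close> followed by squaring.\<close>
  have "M $ u $ u + M $ v $ v - 2 * M $ u $ v = (\<Sum>w\<in>UNIV. (X $ u $ w - X $ v $ w)\<^sup>2)" for u v
    by (simp add: M power2_eq_square algebra_simps sum.distrib sum_subtractf sum_distrib_left)
  then have "M $ u $ u + M $ v $ v - 2 * M $ u $ v \<ge> 0" for u v
    by (simp add: sum_nonneg)
  then have "(biharmonic_dist G u v)\<^sup>2 = M $ u $ u + M $ v $ v - 2 * M $ u $ v" for u v
    by (simp add: biharmonic_dist_def Let_def flip: X_def M_def)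
  moreover have "M *v 1 = 0"
    by (simp add: M_def X flip: matrix_vector_mul_assoc)
  ultimately have "biharmonic_index G = real CARD('v) * trace M"
    using sum_sum_distance_form[of M] by (simp add: biharmonic_index_def UNIV)
  also have "trace M = X \<bullet> X"
    by (simp add: trace_def M inner_matrix)
  finally show ?thesis
    by (simp add: X_def)
qed

section \<open>Complete graphs\<close>

lemma digraph_iso_complete_graph_iff:
  fixes G :: "('v::finite, 'e) pre_digraph"
  assumes G: "Digraph.graph G" and UNIV: "verts G = UNIV" and "card (verts G) = n"
  shows "digraph_iso G (complete_graph n) \<longleftrightarrow> (\<forall>u v. u \<noteq> v \<longrightarrow> u \<rightarrow>\<^bsub>G\<^esub> v)"
proof
  interpret Digraph.graph G by fact
  assume "digraph_iso G (complete_graph n)"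
  then obtain h where h: "digraph_isomorphism h" and eq: "complete_graph n = app_iso h G"
    by (auto simp: digraph_iso_def)
  have inj: "inj (iso_verts h)"
    using digraph_isomorphism_inj_on_verts[OF h] UNIV by simp
  have img: "iso_verts h ` UNIV = {..<n}"
    using arg_cong[OF eq, of verts] by (simp add: complete_graph_def UNIV)
  show "\<forall>u v. u \<noteq> v \<longrightarrow> u \<rightarrow>\<^bsub>G\<^esub> v"
  proof (intro allI impI)
    fix u v :: 'v assume "u \<noteq> v"
    then have "iso_verts h u \<noteq> iso_verts h v"
      using inj by (simp add: inj_eq)
    moreover have "iso_verts h u < n" "iso_verts h v < n"
      using img by auto
    ultimately have "(iso_verts h u, iso_verts h v) \<in> arcs_ends (complete_graph n)"
      by (auto simp: complete_graph_def arcs_ends_conv image_iff)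
    then show "u \<rightarrow>\<^bsub>G\<^esub> v"
      using inj by (auto simp: eq arcs_ends_app_iso_eq[OF h] inj_eq)
  qed
next
  interpret Digraph.graph G by fact
  assume complete: "\<forall>u v. u \<noteq> v \<longrightarrow> u \<rightarrow>\<^bsub>G\<^esub> v"
  obtain f :: "'v \<Rightarrow> nat" where f: "bij_betw f UNIV {..<n}"
    using assms(2,3) ex_bij_betw_finite_nat[of "UNIV :: 'v set"] by (auto simp: lessThan_atLeast0)
  then have inj: "inj f" and img: "range f = {..<n}"
    by (auto simp: bij_betw_def)
  \<comment> \<open>Any numbering \<open>f\<close> of the vertices works. Arcs must go to pairs of
    numbers because the arcs of \<open>complete_graph\<close> are such pairs, with
    \<open>fst\<close> and \<open>snd\<close> as ends.\<close>
  define h where "h = \<lparr>iso_verts = f, iso_arcs = \<lambda>a. (f (tail G a), f (head G a)),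
    iso_head = snd, iso_tail = fst\<rparr>"
  have "inj_on (\<lambda>a. (f (tail G a), f (head G a))) (arcs G)"
    by (rule inj_onI) (simp add: inj_eq[OF inj] arc_to_ends_def no_multi_arcs)
  then have "digraph_isomorphism h"
    using inj by (simp add: digraph_isomorphism_def h_def UNIV wf_digraph)
  moreover have "(\<lambda>a. (f (tail G a), f (head G a))) ` arcs G = {(i, j). i < n \<and> j < n \<and> i \<noteq> j}"
    (is "?A = ?B")
  \<comment> \<open>Absence of loops gives the first inclusion, completeness of \<open>G\<close> the
    second.\<close>
  proof
    show "?A \<subseteq> ?B"
    proof
      fix p assume "p \<in> ?A"
      then obtain a where "a \<in> arcs G" and p: "p = (f (tail G a), f (head G a))"
        by blast
      then have "f (tail G a) \<noteq> f (head G a)"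
        using no_loops inj by (metis injD)
      moreover have "f u < n" for u
        using bij_betwE[OF f] by simp
      ultimately show "p \<in> ?B"
        by (simp add: p)
    qed
    show "?B \<subseteq> ?A"
    proof
      fix p assume "p \<in> ?B"
      then obtain i j where p: "p = (i, j)" "i \<noteq> j" and "i \<in> range f" "j \<in> range f"
        by (auto simp: img)
      then obtain u v where uv: "i = f u" "j = f v"
        by blast
      with p complete have "u \<rightarrow>\<^bsub>G\<^esub> v"
        by simp metis
      then obtain a where "a \<in> arcs G" "tail G a = u" "head G a = v"
        by (rule reachableE)
      with p uv show "p \<in> ?A"
        by (auto intro!: image_eqI[of _ _ a])
    qed
  qed
  then have "complete_graph n = app_iso h G"
    by (simp add: complete_graph_def app_iso_def h_def UNIV img)
  ultimately show "digraph_iso G (complete_graph n)"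
    by (auto simp: digraph_iso_def)
qed

lemma pseudoinverse_multiple_centering_iff:
  fixes G :: "('v::finite, 'e) pre_digraph"
  assumes G: "Digraph.graph G" and "verts G = UNIV" and "Digraph_Component.connected G"
    and n: "CARD('v) \<ge> 2"
  defines "X \<equiv> moore_penrose (laplacian G)"
  shows "X = (trace X / (real CARD('v) - 1)) *\<^sub>R centering \<longleftrightarrow> (\<forall>u v. u \<noteq> v \<longrightarrow> u \<rightarrow>\<^bsub>G\<^esub> v)"
proof
  note X = laplacian_pseudoinverse[OF assms(1-3), folded X_def]
  have LP: "laplacian G ** centering = laplacian G"
    using laplacian_one[OF G] by (rule matrix_mult_centering)
  define c where "c = trace X / (real CARD('v) - 1)"
  assume "X = (trace X / (real CARD('v) - 1)) *\<^sub>R centering"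
  \<comment> \<open>With L the Laplacian and P = \<open>centering\<close>: P = L X = c L P = c
    L.\<close>
  then have "centering = c *\<^sub>R laplacian G"
    using X(3) LP by (metis c_def matrix_scalar_ac scalar_matrix_assoc)
  then have "centering $ u $ v = c * laplacian G $ u $ v" for u v
    by (metis real_scaleR_def vector_scaleR_component)
  \<comment> \<open>These entries are -1/n.\<close>
  moreover have "(centering :: real^'v^'v) $ u $ v \<noteq> 0" if "u \<noteq> v" for u v
    using that by (simp add: centering_def)
  ultimately have "laplacian G $ u $ v \<noteq> 0" if "u \<noteq> v" for u v
    using that by (metis mult_zero_right)
  then have "u \<rightarrow>\<^bsub>G\<^esub> v" if "u \<noteq> v" for u v
    using that by (fastforce simp: laplacian_nth[OF G] adjacency_matrix_def split: if_splits)
  then show "\<forall>u v. u \<noteq> v \<longrightarrow> u \<rightarrow>\<^bsub>G\<^esub> v"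
    by blast
next
  interpret Digraph.graph G by fact
  note X = laplacian_pseudoinverse[OF assms(1-3), folded X_def]
  assume "\<forall>u v. u \<noteq> v \<longrightarrow> u \<rightarrow>\<^bsub>G\<^esub> v"
  then have adj: "u \<rightarrow>\<^bsub>G\<^esub> v \<longleftrightarrow> u \<noteq> v" for u v
    using adj_not_same by auto
  have "(\<Sum>v\<in>UNIV. adjacency_matrix G $ u $ v) = real CARD('v) - 1" for u
  proof -
    have "(\<Sum>v\<in>UNIV. adjacency_matrix G $ u $ v) = (\<Sum>v\<in>UNIV. 1 - (if u = v then 1 else 0))"
      by (rule sum.cong) (auto simp: adjacency_matrix_def adj)
    then show ?thesis
      by (simp add: sum_subtractf)
  qed
  \<comment> \<open>All degrees are n - 1 and all off-diagonal entries -1, so the Laplacian is n I -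
    J = n P.\<close>
  then have "laplacian G = real CARD('v) *\<^sub>R centering"
    by (simp add: vec_eq_iff laplacian_nth[OF G] centering_def adjacency_matrix_def adj
        right_diff_distrib)
  then have "centering = real CARD('v) *\<^sub>R (centering ** X)"
    using X(3) by (simp add: scalar_matrix_assoc)
  also have "centering ** X = X"
    by (metis X(1,2) matrix_mult_centering matrix_transpose_mul transpose_centering)
  finally have "centering = real CARD('v) *\<^sub>R X" .
  then have "(1 / real CARD('v)) *\<^sub>R centering = (1 / real CARD('v)) *\<^sub>R real CARD('v) *\<^sub>R X"
    by (rule arg_cong)
  then have X_eq: "X = (1 / real CARD('v)) *\<^sub>R centering"
    by simp
  \<comment> \<open>Taking traces identifies the coefficient 1/n with the required
    \<open>trace X / (n - 1)\<close>.\<close>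
  have "trace ((1 / real CARD('v)) *\<^sub>R centering :: real^'v^'v)
      = 1 / real CARD('v) * trace (centering :: real^'v^'v)"
    by (simp add: trace_def sum_distrib_left)
  with X_eq have "trace X = 1 / real CARD('v) * (real CARD('v) - 1)"
    by (simp add: trace_centering)
  then have "trace X / (real CARD('v) - 1) = 1 / real CARD('v)"
    using n by simp
  with X_eq show "X = (trace X / (real CARD('v) - 1)) *\<^sub>R centering"
    by simp
qed

section \<open>The gap between the two sides as a squared norm\<close>

theorem theorem4p3:
  fixes G :: "('v::finite, 'e) pre_digraph" and n :: nat
  assumes "Digraph.graph G"
    and "verts G = UNIV"
    and "Digraph_Component.connected G"
    and "card (verts G) = n"
    and "n \<ge> 2"
  shows "biharmonic_index G \<ge> (kirchhoff_index G)\<^sup>2 / (real n * (real n - 1)) \<and>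
    (biharmonic_index G = (kirchhoff_index G)\<^sup>2 / (real n * (real n - 1)) \<longleftrightarrow>
       digraph_iso G (complete_graph n))"
proof -
  define X where "X = moore_penrose (laplacian G)"
  \<comment> \<open>\<open>R\<close> is the component of \<open>X\<close> orthogonal to
    \<open>centering\<close>. The gap in the inequality will be n times its squared norm, which
    settles the bound and the equality case together.\<close>
  define R where "R = X - (trace X / (real n - 1)) *\<^sub>R centering"
  have n: "CARD('v) = n"
    using assms(2,4) by simp
  have "(real n * trace X)\<^sup>2 / (real n * (real n - 1)) = real n * ((trace X)\<^sup>2 / (real n - 1))"
    using assms(5) by (simp add: power_mult_distrib power2_eq_square[of "real n"])
  then have "biharmonic_index G - (kirchhoff_index G)\<^sup>2 / (real n * (real n - 1))
      = real n * (X \<bullet> X - (trace X)\<^sup>2 / (real n - 1))"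
    by (simp only: biharmonic_index_eq_inner[OF assms(1-3)] kirchhoff_index_eq_trace[OF assms(1-3)]
        n right_diff_distrib X_def)
  also have "X \<bullet> X - (trace X)\<^sup>2 / (real n - 1) = (norm R)\<^sup>2"
    using norm_centering_residual[of X] laplacian_pseudoinverse(2)[OF assms(1-3)] assms(5)
    by (simp add: R_def X_def n)
  finally have diff: "biharmonic_index G - (kirchhoff_index G)\<^sup>2 / (real n * (real n - 1))
      = real n * (norm R)\<^sup>2" .
  have "R = 0 \<longleftrightarrow> digraph_iso G (complete_graph n)"
    using pseudoinverse_multiple_centering_iff[OF assms(1-3)] assms(5)
      digraph_iso_complete_graph_iff[OF assms(1,2,4)]
    by (simp add: R_def X_def n)
  moreover have "real n * (norm R)\<^sup>2 \<ge> 0" and "real n * (norm R)\<^sup>2 = 0 \<longleftrightarrow> R = 0"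
    using assms(5) by simp_all
  ultimately show ?thesis
    using diff by (smt (verit))
qed

end
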